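(* Let $r\ge2$ be an integer, and let $X_1,\dots,X_N$ be independent integrable real-valued random variables such that $\mathsf{E}\big[|X_i-\mathsf{E}[X_i]|^r\big]<\infty$ and $\mathsf{Var}[X_i]<\infty$ for $1\le i\le N$. Define $$S_N=\sum_{i=1}^N\big(X_i-\mathsf{E}[X_i]\big),\qquad V_N=\sum_{i=1}^N\mathsf{Var}[X_i],\qquad Z_N=\frac{S_N}{\sqrt{V_N}}.$$ If $V_N>0$, then $$|\kappa_r(Z_N)|\le C^{\mathrm{cen}}_r\,V_N^{-r/2}\sum_{i=1}^N\mathsf{E}\big[|X_i-\mathsf{E}[X_i]|^r\big].$$
   Context: $\mathcal{P}(r)$ is the set of all set partitions of $\{1,\dots,r\}$ into nonempty blocks, and $|\pi|$ is the number of blocks of $\pi$. For a random variable $Y$ with $\mathsf{E}[|Y|^r]<\infty$, the $r$-th cumulant is $$\kappa_r(Y)=\sum_{\pi\in\mathcal{P}(r)}(-1)^{|\pi|-1}(|\pi|-1)!\prod_{B\in\pi}\mathsf{E}[Y^{|B|}].$$ The coefficient is $C^{\mathrm{cen}}_r=\sum_{\pi}(|\pi|-1)!$, the sum running over all $\pi\in\mathcal{P}(r)$ all of whose blocks have size at least $2$. *)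

theory Defs
  imports "HOL-Probability.Probability"
begin

definition set_partitions :: "nat \<Rightarrow> nat set set set" where
  "set_partitions r = {P. partition_on {1..r} P}"

(* The Bochner integral of a non-integrable function is 0, so this is the r-th
   cumulant only if Y has a finite r-th absolute moment; r = 0 has no meaning. *)
definition cumulant :: "'a measure \<Rightarrow> nat \<Rightarrow> ('a \<Rightarrow> real) \<Rightarrow> real" where
  "cumulant M r Y =
     (\<Sum>P\<in>set_partitions r. (-1) ^ (card P - 1) * fact (card P - 1) *
        (\<Prod>B\<in>P. prob_space.expectation M (\<lambda>\<omega>. Y \<omega> ^ card B)))"

definition C_cen :: "nat \<Rightarrow> real" where
  "C_cen r = (\<Sum>P\<in>{P \<in> set_partitions r. \<forall>B\<in>P. 2 \<le> card B}. fact (card P - 1))"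

definition centered_sum :: "'a measure \<Rightarrow> (nat \<Rightarrow> 'a \<Rightarrow> real) \<Rightarrow> nat \<Rightarrow> 'a \<Rightarrow> real" where
  "centered_sum M X N \<omega> = (\<Sum>i = 1..N. X i \<omega> - prob_space.expectation M (X i))"

definition variance_sum :: "'a measure \<Rightarrow> (nat \<Rightarrow> 'a \<Rightarrow> real) \<Rightarrow> nat \<Rightarrow> real" where
  "variance_sum M X N = (\<Sum>i = 1..N. prob_space.variance M (X i))"

definition normalized_sum :: "'a measure \<Rightarrow> (nat \<Rightarrow> 'a \<Rightarrow> real) \<Rightarrow> nat \<Rightarrow> 'a \<Rightarrow> real" where
  "normalized_sum M X N \<omega> = centered_sum M X N \<omega> / sqrt (variance_sum M X N)"

end

theory Submission
  imports Defs "HOL-Computational_Algebra.Formal_Power_Series"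
begin

text \<open>
  The cumulant of an independent sum is the sum of the cumulants, and the $r$-th cumulant is
  homogeneous of degree $r$. With $Y_i = X_i - E X_i$ this gives
  $\kappa_r(Z_N) = V_N^{-r/2} \sum_i \kappa_r(Y_i)$, so that it suffices to bound the cumulant of
  one centered variable $Y$ by the coefficient times $E |Y|^r$.

  For the centered bound (\<open>abs_cumulant_centered_le\<close>), a partition with a block of size one
  contributes the factor $E Y = 0$. On each remaining partition $\pi$, Lyapunov's inequality
  $E |Y|^k \le (E |Y|^r)^{k/r}$ bounds the product of the moments by
  $(E |Y|^r)^{\sum_B |B| / r} = E |Y|^r$, because the block sizes add up to $r$. The weights
  $(|\pi| - 1)!$ are what is left, and they sum to the coefficient.

  Additivity (\<open>cumulant_sum_indep\<close>) is a statement about number sequences. Independence enters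
  only through the moments of $X + Y$, which are the binomial convolution of the moments of $X$ and
  of $Y$; in terms of exponential generating functions, $M_{X+Y} = M_X M_Y$. The partition formula
  is equivalent to $M' = K' M$ where $K$ is the generating function of the cumulants: the
  coefficients of this identity are the recursion
  $m(A) = \sum_{a \in B \subseteq A} \kappa(B) \, m(A - B)$, which follows from a cancellation
  among partitions (\<open>set_cumulant_recursion\<close>). By the product rule
  $K_{X+Y}' M_{X+Y} = (K_X' + K_Y') M_{X+Y}$, and formal power series over the reals form an
  integral domain, so $K_{X+Y}' = K_X' + K_Y'$.
\<close>

section \<open>Cumulants of a number sequence\<close>

text \<open>
  The index set is an arbitrary set, not only an initial segment of the naturals, because the
  recursion below restricts to subsets; the moments form an arbitrary sequence, so that the
  algebra does not depend on which moments exist.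
\<close>

definition set_cumulant :: "(nat \<Rightarrow> real) \<Rightarrow> 'b set \<Rightarrow> real" where
  "set_cumulant m A = (\<Sum>P | partition_on A P.
     (-1) ^ (card P - 1) * fact (card P - 1) * (\<Prod>B\<in>P. m (card B)))"

lemma partition_on_image_inj:
  assumes "partition_on A P" "inj_on f A"
  shows "partition_on (f ` A) ((`) f ` P)"
proof -
  have "{} \<notin> (`) f ` P"
    using partition_onD3[OF assms(1)] by auto
  then show ?thesis
    using partition_on_inj_image[OF assms] by simp
qed

lemma set_cumulant_image:
  assumes "inj_on f A"
  shows "set_cumulant m (f ` A) = set_cumulant m A"
proof -
  let ?g = "inv_into A f"
  have inv: "?g ` f ` B = B" if "B \<subseteq> A" for B
    using assms that by (simp add: image_inv_into_cancel inj_on_image_eq_iff inv_into_image_cancel)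
  have sub: "B \<subseteq> A" if "partition_on A P" "B \<in> P" for P B
    using that by (auto dest: partition_onD1)
  have pull: "partition_on A ((`) ?g ` Q)" if "partition_on (f ` A) Q" for Q
    using partition_on_image_inj[OF that inj_on_inv_into[of "f ` A" f A]] inv[of A] by simp
  have fwd_back: "(`) f ` (`) ?g ` Q = Q" if "partition_on (f ` A) Q" for Q
  proof -
    have "f ` ?g ` B = B" if "B \<in> Q" for B
    proof (rule image_inv_into_cancel[OF refl])
      show "B \<subseteq> f ` A"
        using partition_onD1[OF \<open>partition_on (f ` A) Q\<close>] that by blast
    qed
    then show ?thesis by (force simp: image_iff)
  qed
  have back_fwd: "(`) ?g ` (`) f ` P = P" if "partition_on A P" for P
    using inv sub[OF that] by (force simp: image_iff)
  have card_block: "card (f ` B) = card B" if "B \<subseteq> A" for B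
    using assms that by (meson card_image inj_on_subset)
  have inj_blocks: "inj_on ((`) f) P" if "partition_on A P" for P
    by (rule inj_on_inverseI[where g = "(`) ?g"]) (use inv sub[OF that] in auto)
  show ?thesis
    unfolding set_cumulant_def
  proof (rule sum.reindex_bij_witness[where i = "(`) ((`) f)" and j = "(`) ((`) ?g)"], goal_cases)
    case (1 Q)
    then show ?case using fwd_back by auto
  next
    case (2 Q)
    then show ?case using pull by auto
  next
    case (3 P)
    then show ?case using back_fwd by auto
  next
    case (4 P)
    then show ?case using partition_on_image_inj[OF _ assms] by auto
  next
    case (5 Q)
    define P where "P = (`) ?g ` Q"
    have P: "partition_on A P" and Q: "Q = (`) f ` P"
      using 5 pull fwd_back by (auto simp: P_def)
    have "card Q = card P"
      unfolding Q by (rule card_image[OF inj_blocks[OF P]])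
    moreover have "(\<Prod>B\<in>Q. m (card B)) = (\<Prod>B\<in>P. m (card B))"
      unfolding Q prod.reindex[OF inj_blocks[OF P]]
      using sub[OF P] by (intro prod.cong) (auto simp: card_block)
    ultimately show ?case
      by (simp add: P_def)
  qed
qed

lemma set_cumulant_card_cong:
  assumes "finite A" "finite B" "card A = card B"
  shows "set_cumulant m A = set_cumulant m B"
proof -
  obtain f where "bij_betw f A B"
    using finite_same_card_bij[OF assms] by blast
  then show ?thesis
    using set_cumulant_image[of f A m] by (auto simp: bij_betw_def)
qed

text \<open>
  This is the recursion of moments by cumulants, with a distinguished point $a$. Expand every
  $\kappa(B)$ with $B \ne A$ over the partitions $P$ of $B$. Adding the complement $A - B$ to $P$
  yields a partition $Q$ of $A$ in which one block avoiding $a$ is marked, and every such pair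
  arises exactly once. A partition $Q$ with $j$ blocks has $j - 1$ blocks avoiding $a$, so it
  receives the weight $(j-1) \cdot (-1)^{j-2} (j-2)!$, which for $j \ge 2$ is the negative of its
  weight in $\kappa(A)$; the term $B = A$ is $\kappa(A)$ itself, as $m(\emptyset) = 1$.
  Only the partition with the single block $A$ survives.
\<close>

lemma set_cumulant_recursion:
  assumes A: "finite A" "a \<in> A" and m0: "m 0 = 1"
  shows "(\<Sum>B | a \<in> B \<and> B \<subseteq> A. set_cumulant m B * m (card (A - B))) = m (card A)"
proof -
  define w :: "nat \<Rightarrow> real" where "w j = (-1) ^ (j - 1) * fact (j - 1)" for j
  define c where "c P = (\<Prod>B\<in>P. m (card B))" for P :: "'a set set"
  have sc: "set_cumulant m B = (\<Sum>P | partition_on B P. w (card P) * c P)" for B :: "'a set"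
    by (simp add: set_cumulant_def w_def c_def)
  have finP: "finite {P. partition_on B P}" if "B \<subseteq> A" for B
    using A that by (intro finitely_many_partition_on) (auto intro: finite_subset)
  have fin_part: "finite P" if "partition_on B P" "B \<subseteq> A" for P B
    using A that by (meson finite_elements finite_subset)
  have new_block: "A - B \<notin> P" if P: "partition_on B P" and B: "B \<subset> A" for P B
  proof
    assume "A - B \<in> P"
    then have "A - B \<subseteq> B" using partition_onD1[OF P] by auto
    then show False using B by auto
  qed
  have fin_sub: "finite {B. a \<in> B \<and> B \<subset> A}"
    by (rule finite_subset[of _ "Pow A"]) (use A in auto)
  have split: "{B. a \<in> B \<and> B \<subseteq> A} = insert A {B. a \<in> B \<and> B \<subset> A}"
    using A by auto
  let ?L = "SIGMA B:{B. a \<in> B \<and> B \<subset> A}. {P. partition_on B P}"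
  let ?R = "SIGMA Q:{Q. partition_on A Q}. {C \<in> Q. a \<notin> C}"
  have "(\<Sum>B | a \<in> B \<and> B \<subset> A. set_cumulant m B * m (card (A - B)))
      = (\<Sum>(B, P)\<in>?L. w (card P) * c P * m (card (A - B)))"
    using finP fin_sub by (subst sum.Sigma[symmetric]) (auto simp: sc sum_distrib_right)
  also have "\<dots> = (\<Sum>(Q, C)\<in>?R. w (card Q - 1) * c Q)"
  proof (rule sum.reindex_bij_witness[where
        i = "\<lambda>(Q, C). (A - C, Q - {C})" and j = "\<lambda>(B, P). (insert (A - B) P, A - B)"], goal_cases)
    case (1 p)
    obtain B P where p: "p = (B, P)" by (cases p)
    have P: "partition_on B P" and B: "a \<in> B" "B \<subset> A" using 1 p by auto
    show ?case using p B new_block[OF P] by auto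
  next
    case (2 p)
    obtain B P where p: "p = (B, P)" by (cases p)
    have P: "partition_on B P" and B: "a \<in> B" "B \<subset> A" using 2 p by auto
    have "disjnt (A - B) (\<Union>P)"
      using partition_onD1[OF P] by (auto simp: disjnt_def)
    moreover have "A - (A - B) = B" using B by auto
    ultimately have "partition_on A (insert (A - B) P)"
      using P B by (subst partition_on_insert) auto
    then show ?case using p B by auto
  next
    case (3 q)
    obtain Q C where q: "q = (Q, C)" by (cases q)
    have "partition_on A Q" "C \<in> Q" "a \<notin> C" using 3 q by auto
    then have "C \<subseteq> A" by (auto dest: partition_onD1)
    then show ?case using q \<open>C \<in> Q\<close> by (auto simp: double_diff)
  next
    case (4 q)
    obtain Q C where q: "q = (Q, C)" by (cases q)
    have Q: "partition_on A Q" and C: "C \<in> Q" "a \<notin> C" using 4 q by auto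
    have CA: "C \<subseteq> A" "C \<noteq> {}" using Q C by (auto dest: partition_onD1 partition_onD3)
    have dis: "disjnt C (\<Union>(Q - {C}))"
      using partition_onD2[OF Q] C by (auto simp: pairwise_def disjnt_def)
    have "partition_on (A - C) (Q - {C})"
      using partition_on_insert[OF dis, of A] Q C by (simp add: insert_absorb)
    then show ?case using q CA C A by auto
  next
    case (5 p)
    obtain B P where p: "p = (B, P)" by (cases p)
    have P: "partition_on B P" and B: "a \<in> B" "B \<subset> A" using 5 p by auto
    show ?case using p fin_part[OF P] B new_block[OF P] by (simp add: c_def mult_ac)
  qed
  also have "\<dots> = (\<Sum>Q | partition_on A Q. real (card Q - 1) * (w (card Q - 1) * c Q))"
  proof -
    \<comment> \<open>Exactly one block of \<open>Q\<close> contains \<open>a\<close>.\<close>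
    have "card {C \<in> Q. a \<notin> C} = card Q - 1" if Q: "partition_on A Q" for Q
    proof -
      obtain D where D: "D \<in> Q" "a \<in> D" using A partition_onD1[OF Q] by auto
      then have "{C \<in> Q. a \<notin> C} = Q - {D}"
        using partition_onD2[OF Q] by (auto simp: pairwise_def disjnt_def)
      then show ?thesis using D by simp
    qed
    then show ?thesis
      using finP[of A] fin_part[of A] by (subst sum.Sigma[symmetric]) auto
  qed
  \<comment> \<open>For a one-block \<open>Q\<close> the junk value \<open>w 0\<close> is harmless: its coefficient \<open>card Q - 1\<close> is zero.\<close>
  finally have rest: "(\<Sum>B | a \<in> B \<and> B \<subset> A. set_cumulant m B * m (card (A - B)))
      = (\<Sum>Q | partition_on A Q. real (card Q - 1) * (w (card Q - 1) * c Q))" .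
  have "(\<Sum>B | a \<in> B \<and> B \<subseteq> A. set_cumulant m B * m (card (A - B)))
      = set_cumulant m A + (\<Sum>B | a \<in> B \<and> B \<subset> A. set_cumulant m B * m (card (A - B)))"
    unfolding split using fin_sub m0 by (subst sum.insert) auto
  also have "\<dots> = (\<Sum>Q | partition_on A Q. (w (card Q) + real (card Q - 1) * w (card Q - 1)) * c Q)"
    unfolding rest sc[of A] by (simp add: sum.distrib algebra_simps)
  also have "\<dots> = (\<Sum>Q | partition_on A Q. if Q = {A} then m (card A) else 0)"
  proof (rule sum.cong[OF refl])
    fix Q assume "Q \<in> {Q. partition_on A Q}"
    then have Q: "partition_on A Q" by simp
    have "Q \<noteq> {}" using A partition_onD1[OF Q] by auto
    then have "card Q \<noteq> 0" using fin_part[OF Q] by simp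
    then consider "card Q = 1" | k where "card Q = Suc (Suc k)"
      by (metis One_nat_def not0_implies_Suc)
    then show "(w (card Q) + real (card Q - 1) * w (card Q - 1)) * c Q
        = (if Q = {A} then m (card A) else 0)"
    proof cases
      case 1
      then have "Q = {A}" using partition_onD1[OF Q] by (auto simp: card_1_singleton_iff)
      then show ?thesis by (simp add: w_def c_def)
    next
      case 2
      then have "Q \<noteq> {A}" by auto
      moreover have "w (card Q) + real (card Q - 1) * w (card Q - 1) = 0"
        using 2 by (simp add: w_def algebra_simps)
      ultimately show ?thesis by simp
    qed
  qed
  also have "\<dots> = m (card A)"
    using finP[of A] A partition_on_space[of A] by (subst sum.delta) auto
  finally show ?thesis .
qed

lemma sum_card_Pow:
  assumes "finite A"
  shows "(\<Sum>T\<in>Pow A. f (card T)) = (\<Sum>k\<le>card A. of_nat (card A choose k) * (f k :: real))"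
proof -
  have "(\<Sum>T\<in>Pow A. f (card T)) = (\<Sum>k\<le>card A. \<Sum>T\<in>{T \<in> Pow A. card T = k}. f (card T))"
    using assms by (subst sum.group) (auto intro: card_mono)
  also have "\<dots> = (\<Sum>k\<le>card A. of_nat (card A choose k) * f k)"
    using n_subsets[OF assms] by (intro sum.cong) auto
  finally show ?thesis .
qed

text \<open>
  The set recursion on \<open>{0..n}\<close> with distinguished point $0$, where the subsets containing $0$ are
  collected by size.
\<close>

lemma moment_cumulant_recursion:
  assumes m0: "m 0 = 1"
  shows "m (Suc n) = (\<Sum>k\<le>n. real (n choose k) * (set_cumulant m {1..Suc k} * m (n - k)))"
proof -
  have "m (Suc n) = (\<Sum>B | 0 \<in> B \<and> B \<subseteq> {0..n}. set_cumulant m B * m (card ({0..n} - B)))"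
    by (subst set_cumulant_recursion) (use m0 in auto)
  also have "\<dots> = (\<Sum>T\<in>Pow {1..n}. set_cumulant m {1..Suc (card T)} * m (n - card T))"
  proof (rule sum.reindex_bij_witness[where i = "insert 0" and j = "\<lambda>B. B - {0}"], goal_cases)
    case (2 B)
    then show ?case by (auto simp: subset_iff Suc_le_eq)
  next
    case (5 B)
    then have fin: "finite B" by (auto intro: finite_subset)
    have card: "card B = Suc (card (B - {0}))"
      using 5 fin card.remove[of B 0] by simp
    have "set_cumulant m B = set_cumulant m {1..Suc (card (B - {0}))}"
      using fin card by (intro set_cumulant_card_cong) auto
    moreover have "card ({0..n} - B) = n - card (B - {0})"
      using 5 fin card by (subst card_Diff_subset) auto
    ultimately show ?case by simp
  qed auto
  also have "\<dots> = (\<Sum>k\<le>n. real (n choose k) * (set_cumulant m {1..Suc k} * m (n - k)))"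
    using sum_card_Pow[of "{1..n}" "\<lambda>k. set_cumulant m {1..Suc k} * m (n - k)"] by simp
  finally show ?thesis .
qed

section \<open>Additivity through exponential generating functions\<close>

definition egf :: "(nat \<Rightarrow> real) \<Rightarrow> real fps" where
  "egf u = Abs_fps (\<lambda>n. u n / fact n)"

lemma egf_mult:
  "egf u * egf v = egf (\<lambda>n. \<Sum>k\<le>n. real (n choose k) * (u k * v (n - k)))"
proof (rule fps_ext)
  fix n
  have "fps_nth (egf u * egf v) n = (\<Sum>k\<le>n. u k / fact k * (v (n - k) / fact (n - k)))"
    by (simp add: fps_mult_nth egf_def atMost_atLeast0)
  also have "\<dots> = (\<Sum>k\<le>n. real (n choose k) * (u k * v (n - k)) / fact n)"
    by (intro sum.cong) (auto simp: binomial_fact field_simps)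
  finally show "fps_nth (egf u * egf v) n
      = fps_nth (egf (\<lambda>n. \<Sum>k\<le>n. real (n choose k) * (u k * v (n - k)))) n"
    by (simp add: egf_def sum_divide_distrib)
qed

lemma fps_deriv_egf: "fps_deriv (egf u) = egf (\<lambda>n. u (Suc n))"
proof (rule fps_ext)
  fix n
  have "(1 + real n) * u (Suc n) / ((1 + real n) * fact n) = u (Suc n) / fact n"
    by (rule mult_divide_mult_cancel_left) simp
  then show "fps_nth (fps_deriv (egf u)) n = fps_nth (egf (\<lambda>n. u (Suc n))) n"
    by (simp add: egf_def)
qed

text \<open>
  The differential equation $M' = K' M$: its coefficients are the moment-cumulant recursion.
  The shift from \<open>n\<close> to \<open>Suc n\<close> is the derivative of the generating function of the cumulants.
\<close>

lemma deriv_moment_egf: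
  assumes "m 0 = 1"
  shows "fps_deriv (egf m) = egf (\<lambda>n. set_cumulant m {1..Suc n}) * egf m"
  unfolding fps_deriv_egf egf_mult moment_cumulant_recursion[of m, OF assms] ..

lemma set_cumulant_moment_cong:
  assumes "\<And>k. k \<le> card A \<Longrightarrow> u k = v k" "finite A"
  shows "set_cumulant u A = set_cumulant v A"
  unfolding set_cumulant_def
proof (intro sum.cong refl arg_cong2[where f = "(*)"] prod.cong)
  fix P B assume "P \<in> {P. partition_on A P}" "B \<in> P"
  then have "B \<subseteq> A" by (auto dest: partition_onD1)
  then show "u (card B) = v (card B)"
    using assms by (auto intro: card_mono)
qed

text \<open>
  The logarithmic derivative turns products of generating functions into sums. The sequence $w$ is
  compared with the full convolution $W$, since $w$ is constrained only up to index $r$ while the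
  identity of power series involves all indices.
\<close>

lemma set_cumulant_binomial_convolution:
  assumes u0: "u 0 = 1" and v0: "v 0 = 1" and r: "1 \<le> r"
    and w: "\<And>n. n \<le> r \<Longrightarrow> w n = (\<Sum>k\<le>n. real (n choose k) * (u k * v (n - k)))"
  shows "set_cumulant w {1..r} = set_cumulant u {1..r} + set_cumulant v {1..r}"
proof -
  define W where "W n = (\<Sum>k\<le>n. real (n choose k) * (u k * v (n - k)))" for n
  have W0: "W 0 = 1" by (simp add: W_def u0 v0)
  let ?K = "\<lambda>m. egf (\<lambda>n. set_cumulant m {1..Suc n})"
  have WM: "egf W = egf u * egf v"
    by (simp add: egf_mult W_def[abs_def])
  have "?K W * egf W = fps_deriv (egf u * egf v)"
    using deriv_moment_egf[of W, OF W0] unfolding WM by simp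
  also have "\<dots> = (?K u + ?K v) * egf W"
    by (simp add: deriv_moment_egf[of u, OF u0] deriv_moment_egf[of v, OF v0] WM algebra_simps)
  finally have "?K W * egf W = (?K u + ?K v) * egf W" .
  moreover have "fps_nth (egf W) 0 \<noteq> 0"
    by (simp add: egf_def W0)
  then have "egf W \<noteq> 0" by auto
  ultimately have "?K W = ?K u + ?K v" by simp
  then have "fps_nth (?K W) (r - 1) = fps_nth (?K u + ?K v) (r - 1)" by simp
  then have "set_cumulant W {1..r} = set_cumulant u {1..r} + set_cumulant v {1..r}"
    using r by (simp add: egf_def field_simps)
  moreover have "set_cumulant w {1..r} = set_cumulant W {1..r}"
    by (rule set_cumulant_moment_cong) (auto simp: w W_def)
  ultimately show ?thesis by simp
qed

section \<open>Cumulants of random variables\<close>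

lemma cumulant_eq_set_cumulant:
  "cumulant M r Y = set_cumulant (\<lambda>k. prob_space.expectation M (\<lambda>\<omega>. Y \<omega> ^ k)) {1..r}"
  by (simp add: cumulant_def set_cumulant_def set_partitions_def)

lemma set_partitions_sum_card:
  assumes "P \<in> set_partitions r"
  shows "finite P" "(\<Sum>B\<in>P. card B) = r" "\<And>B. B \<in> P \<Longrightarrow> 1 \<le> card B \<and> card B \<le> r"
proof -
  have P: "partition_on {1..r} P"
    using assms by (simp add: set_partitions_def)
  show "finite P"
    by (rule finite_elements[OF _ P]) simp
  have sub: "B \<subseteq> {1..r}" if "B \<in> P" for B
    using partition_onD1[OF P] that by auto
  then have fin: "finite B" if "B \<in> P" for B
    using that by (meson finite_atLeastAtMost finite_subset)
  show "(\<Sum>B\<in>P. card B) = r"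
    using product_partition[OF P fin] by simp
  show "1 \<le> card B \<and> card B \<le> r" if "B \<in> P" for B
    using partition_onD3[OF P] that fin[OF that] card_mono[OF _ sub[OF that]]
    by (auto simp: Suc_le_eq card_gt_0_iff)
qed

lemma finite_set_partitions: "finite (set_partitions r)"
  unfolding set_partitions_def by (rule finitely_many_partition_on) simp

text \<open>
  Every partition contributes one factor $c^{-|B|}$ for each block, and the block sizes add up to
  $r$.
\<close>

lemma cumulant_scale:
  "cumulant M r (\<lambda>\<omega>. Y \<omega> / c) = cumulant M r Y / c ^ r"
proof -
  have "(\<Prod>B\<in>P. prob_space.expectation M (\<lambda>\<omega>. (Y \<omega> / c) ^ card B))
      = (\<Prod>B\<in>P. prob_space.expectation M (\<lambda>\<omega>. Y \<omega> ^ card B)) / c ^ r"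
    if "P \<in> set_partitions r" for P
    using set_partitions_sum_card(2)[OF that]
    by (simp add: power_divide prod_dividef flip: power_sum)
  then show ?thesis
    by (simp add: cumulant_def sum_divide_distrib)
qed

lemma (in prob_space) integrable_power_le:
  fixes Y :: "'a \<Rightarrow> real"
  assumes "Y \<in> borel_measurable M" "integrable M (\<lambda>\<omega>. \<bar>Y \<omega>\<bar> ^ r)" "k \<le> r"
  shows "integrable M (\<lambda>\<omega>. Y \<omega> ^ k)"
proof (rule Bochner_Integration.integrable_bound[of M "\<lambda>\<omega>. 1 + \<bar>Y \<omega>\<bar> ^ r"])
  have "\<bar>y\<bar> ^ k \<le> 1 + \<bar>y\<bar> ^ r" for y :: real
  proof (cases "\<bar>y\<bar> \<le> 1")
    case True
    then have "\<bar>y\<bar> ^ k \<le> 1" by (intro power_le_one) auto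
    then show ?thesis using zero_le_power[of "\<bar>y\<bar>" r] by linarith
  next
    case False
    then have "\<bar>y\<bar> ^ k \<le> \<bar>y\<bar> ^ r" using assms(3) by (intro power_increasing) auto
    then show ?thesis by linarith
  qed
  then show "AE \<omega> in M. norm (Y \<omega> ^ k) \<le> norm (1 + \<bar>Y \<omega>\<bar> ^ r)"
    by (auto simp: power_abs add_nonneg_nonneg)
qed (use assms in auto)

lemma (in prob_space)
  fixes X Y :: "'a \<Rightarrow> real"
  assumes indep: "indep_var borel X borel Y"
    and X: "\<And>k. k \<le> n \<Longrightarrow> integrable M (\<lambda>\<omega>. X \<omega> ^ k)"
    and Y: "\<And>k. k \<le> n \<Longrightarrow> integrable M (\<lambda>\<omega>. Y \<omega> ^ k)"
  shows indep_integrable_power_add: "integrable M (\<lambda>\<omega>. (X \<omega> + Y \<omega>) ^ n)"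
    and indep_moment_add: "expectation (\<lambda>\<omega>. (X \<omega> + Y \<omega>) ^ n)
      = (\<Sum>k\<le>n. real (n choose k) * (expectation (\<lambda>\<omega>. X \<omega> ^ k) * expectation (\<lambda>\<omega>. Y \<omega> ^ (n - k))))"
proof -
  have ind: "indep_var borel (\<lambda>\<omega>. X \<omega> ^ k) borel (\<lambda>\<omega>. Y \<omega> ^ l)" for k l
    using indep_var_compose[OF indep, of "\<lambda>x. x ^ k" borel "\<lambda>x. x ^ l" borel]
    by (simp add: comp_def)
  have int: "integrable M (\<lambda>\<omega>. X \<omega> ^ k * Y \<omega> ^ (n - k))" if "k \<le> n" for k
    using that by (intro indep_var_integrable[OF ind] X Y) auto
  have exp: "(X \<omega> + Y \<omega>) ^ n = (\<Sum>k\<le>n. real (n choose k) * (X \<omega> ^ k * Y \<omega> ^ (n - k)))" for \<omega>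
    by (simp add: binomial_ring mult_ac)
  show "integrable M (\<lambda>\<omega>. (X \<omega> + Y \<omega>) ^ n)"
    unfolding exp using int by auto
  show "expectation (\<lambda>\<omega>. (X \<omega> + Y \<omega>) ^ n)
      = (\<Sum>k\<le>n. real (n choose k) * (expectation (\<lambda>\<omega>. X \<omega> ^ k) * expectation (\<lambda>\<omega>. Y \<omega> ^ (n - k))))"
    unfolding exp using int
    by (subst Bochner_Integration.integral_sum)
       (auto intro!: sum.cong indep_var_lebesgue_integral[OF ind] X Y)
qed

lemma (in prob_space) cumulant_add_indep:
  fixes X Y :: "'a \<Rightarrow> real"
  assumes "indep_var borel X borel Y" "1 \<le> r"
    and "\<And>k. k \<le> r \<Longrightarrow> integrable M (\<lambda>\<omega>. X \<omega> ^ k)"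
    and "\<And>k. k \<le> r \<Longrightarrow> integrable M (\<lambda>\<omega>. Y \<omega> ^ k)"
  shows "cumulant M r (\<lambda>\<omega>. X \<omega> + Y \<omega>) = cumulant M r X + cumulant M r Y"
  unfolding cumulant_eq_set_cumulant
  by (rule set_cumulant_binomial_convolution)
     (use assms in \<open>auto simp: prob_space intro!: indep_moment_add\<close>)

lemma (in prob_space) cumulant_zero:
  assumes "1 \<le> r"
  shows "cumulant M r (\<lambda>_. 0) = 0"
proof -
  have "(\<Prod>B\<in>P. expectation (\<lambda>_. (0::real) ^ card B)) = 0" if P: "P \<in> set_partitions r" for P
  proof -
    have "P \<noteq> {}" using set_partitions_sum_card(2)[OF P] assms by auto
    then obtain B where B: "B \<in> P" by auto
    have "expectation (\<lambda>_. (0::real) ^ card B) = 0"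
      using set_partitions_sum_card(3)[OF P B] by (simp add: power_0_left)
    then show ?thesis
      using B set_partitions_sum_card(1)[OF P] by (auto intro: prod_zero)
  qed
  then show ?thesis
    by (simp add: cumulant_def)
qed

text \<open>
  Integrability of the powers of the partial sums is carried through the induction together with
  additivity, because the two-variable case needs it for the next summand.
\<close>

lemma (in prob_space) cumulant_sum_indep:
  fixes X :: "'i \<Rightarrow> 'a \<Rightarrow> real"
  assumes "finite I" "indep_vars (\<lambda>_. borel) X I" "1 \<le> r"
    and "\<And>i k. i \<in> I \<Longrightarrow> k \<le> r \<Longrightarrow> integrable M (\<lambda>\<omega>. X i \<omega> ^ k)"
  shows "cumulant M r (\<lambda>\<omega>. \<Sum>i\<in>I. X i \<omega>) = (\<Sum>i\<in>I. cumulant M r (X i))"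
proof -
  have "(\<forall>k\<le>r. integrable M (\<lambda>\<omega>. (\<Sum>i\<in>I. X i \<omega>) ^ k))
      \<and> cumulant M r (\<lambda>\<omega>. \<Sum>i\<in>I. X i \<omega>) = (\<Sum>i\<in>I. cumulant M r (X i))"
    using assms
  proof (induction I rule: finite_induct)
    case empty
    then show ?case by (simp add: cumulant_zero)
  next
    case (insert i I)
    have ind: "indep_var borel (X i) borel (\<lambda>\<omega>. \<Sum>j\<in>I. X j \<omega>)"
      by (rule indep_vars_sum) (use insert in auto)
    have IH: "(\<forall>k\<le>r. integrable M (\<lambda>\<omega>. (\<Sum>j\<in>I. X j \<omega>) ^ k))
        \<and> cumulant M r (\<lambda>\<omega>. \<Sum>j\<in>I. X j \<omega>) = (\<Sum>j\<in>I. cumulant M r (X j))"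
      by (rule insert.IH) (use insert.prems in \<open>auto intro: indep_vars_subset\<close>)
    have "integrable M (\<lambda>\<omega>. (X i \<omega> + (\<Sum>j\<in>I. X j \<omega>)) ^ k)" if "k \<le> r" for k
      by (rule indep_integrable_power_add[OF ind]) (use that IH insert.prems in auto)
    moreover have "cumulant M r (\<lambda>\<omega>. X i \<omega> + (\<Sum>j\<in>I. X j \<omega>))
        = cumulant M r (X i) + cumulant M r (\<lambda>\<omega>. \<Sum>j\<in>I. X j \<omega>)"
      by (rule cumulant_add_indep[OF ind]) (use IH insert.prems in auto)
    ultimately show ?case
      using IH insert.hyps by simp
  qed
  then show ?thesis by simp
qed

section \<open>The bound for a centered variable\<close>

text \<open>
  This is the weighted arithmetic-geometric mean inequality for $x^r$ and $1$, in a form free of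
  division. It follows by induction on $r \ge k$ from
  $k x^r (x - 1) - (x^k - 1) = (x - 1) \sum_{i<k} (x^r - x^i) \ge 0$, where both factors change sign
  at $x = 1$.
\<close>

lemma power_le_weighted:
  fixes x :: real
  assumes "0 \<le> x" "k \<le> r"
  shows "real r * x ^ k \<le> real k * x ^ r + real (r - k)"
  using assms(2)
proof (induction r rule: dec_induct)
  case base
  then show ?case by simp
next
  case (step r)
  have "0 \<le> (x - 1) * (\<Sum>i<k. x ^ r - x ^ i)"
  proof (cases "1 \<le> x")
    case True
    then show ?thesis
      using step by (intro mult_nonneg_nonneg sum_nonneg) (auto intro: power_increasing)
  next
    case False
    then show ?thesis
      using step assms(1) by (intro mult_nonpos_nonpos sum_nonpos) (auto intro: power_decreasing)
  qed
  also have "\<dots> = real k * (x ^ Suc r - x ^ r) - (x ^ k - 1)"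
    by (simp add: sum_subtractf power_diff_1_eq algebra_simps)
  finally have "x ^ k \<le> real k * (x ^ Suc r - x ^ r) + 1" by simp
  with step.IH step.hyps show ?case
    by (simp add: algebra_simps of_nat_diff)
qed

text \<open>
  Lyapunov's inequality, stated with an upper bound $s^r$ of the $r$-th absolute moment. It is the
  expectation of the preceding inequality at $x = |Y| / s$. A free bound $s > 0$ covers the case in
  which the $r$-th moment vanishes, where no division by the norm is possible.
\<close>

lemma (in prob_space) moment_le_power:
  fixes Y :: "'a \<Rightarrow> real"
  assumes Y: "Y \<in> borel_measurable M" "integrable M (\<lambda>\<omega>. \<bar>Y \<omega>\<bar> ^ r)"
    and k: "k \<le> r" "1 \<le> r" and s: "0 < s" "expectation (\<lambda>\<omega>. \<bar>Y \<omega>\<bar> ^ r) \<le> s ^ r"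
  shows "expectation (\<lambda>\<omega>. \<bar>Y \<omega>\<bar> ^ k) \<le> s ^ k"
proof -
  have int: "integrable M (\<lambda>\<omega>. \<bar>Y \<omega>\<bar> ^ k)"
    using integrable_abs[OF integrable_power_le[OF Y k(1)]] by (simp add: power_abs)
  have "real r * expectation (\<lambda>\<omega>. \<bar>Y \<omega>\<bar> ^ k) / s ^ k
      = expectation (\<lambda>\<omega>. real r * (\<bar>Y \<omega>\<bar> / s) ^ k)"
    by (simp add: power_divide)
  also have "\<dots> \<le> expectation (\<lambda>\<omega>. real k * (\<bar>Y \<omega>\<bar> / s) ^ r + real (r - k))"
    using Y int s k by (intro integral_mono power_le_weighted) (auto simp: power_divide)
  also have "\<dots> = real k * expectation (\<lambda>\<omega>. \<bar>Y \<omega>\<bar> ^ r) / s ^ r + real (r - k)"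
    using Y by (simp add: power_divide prob_space)
  also have "\<dots> \<le> real k + real (r - k)"
    using s by (simp add: pos_divide_le_eq mult_left_mono)
  also have "\<dots> = real r"
    using k by (simp add: of_nat_diff)
  finally have "real r * expectation (\<lambda>\<omega>. \<bar>Y \<omega>\<bar> ^ k) \<le> real r * s ^ k"
    using s by (simp add: pos_divide_le_eq)
  then show ?thesis
    using k by simp
qed

text \<open>
  Every $c > E |Y|^r$ is $s^r$ for a positive $s$, and the bounds $s^{|B|}$ multiply to $s^r = c$
  because the block sizes add up to $r$.
\<close>

lemma (in prob_space) prod_moments_le:
  fixes Y :: "'a \<Rightarrow> real"
  assumes Y: "Y \<in> borel_measurable M" "integrable M (\<lambda>\<omega>. \<bar>Y \<omega>\<bar> ^ r)"
    and r: "1 \<le> r" and P: "P \<in> set_partitions r"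
  shows "(\<Prod>B\<in>P. expectation (\<lambda>\<omega>. \<bar>Y \<omega>\<bar> ^ card B)) \<le> expectation (\<lambda>\<omega>. \<bar>Y \<omega>\<bar> ^ r)"
proof (rule dense_ge)
  fix c assume c: "expectation (\<lambda>\<omega>. \<bar>Y \<omega>\<bar> ^ r) < c"
  have c0: "0 < c"
    by (rule le_less_trans[OF _ c]) simp
  define s where "s = root r c"
  have s: "0 < s" "s ^ r = c"
    using c0 r by (auto simp: s_def real_root_pow_pos2)
  have "(\<Prod>B\<in>P. expectation (\<lambda>\<omega>. \<bar>Y \<omega>\<bar> ^ card B)) \<le> (\<Prod>B\<in>P. s ^ card B)"
  proof (rule prod_mono, intro conjI)
    fix B assume "B \<in> P"
    then show "expectation (\<lambda>\<omega>. \<bar>Y \<omega>\<bar> ^ card B) \<le> s ^ card B"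
      using c s r set_partitions_sum_card(3)[OF P, of B]
      by - (rule moment_le_power[OF Y], auto)
  qed simp
  also have "\<dots> = c"
    using set_partitions_sum_card(2)[OF P] s by (simp flip: power_sum)
  finally show "(\<Prod>B\<in>P. expectation (\<lambda>\<omega>. \<bar>Y \<omega>\<bar> ^ card B)) \<le> c" .
qed

text \<open>
  Centering removes the partitions that have a singleton block, and each remaining product of
  moments is at most $E |Y|^r$.
\<close>

lemma (in prob_space) abs_cumulant_centered_le:
  fixes Y :: "'a \<Rightarrow> real"
  assumes Y: "Y \<in> borel_measurable M" "integrable M (\<lambda>\<omega>. \<bar>Y \<omega>\<bar> ^ r)"
    and mean: "expectation Y = 0" and r: "1 \<le> r"
  shows "\<bar>cumulant M r Y\<bar> \<le> C_cen r * expectation (\<lambda>\<omega>. \<bar>Y \<omega>\<bar> ^ r)"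
proof -
  let ?t = "\<lambda>P. (-1) ^ (card P - 1) * fact (card P - 1) *
        (\<Prod>B\<in>P. expectation (\<lambda>\<omega>. Y \<omega> ^ card B)) :: real"
  let ?Q = "{P \<in> set_partitions r. \<forall>B\<in>P. 2 \<le> card B}"
  have "?t P = 0" if P: "P \<in> set_partitions r - ?Q" for P
  proof -
    obtain B where B: "B \<in> P" "card B < 2" using P by auto
    then have "card B = 1" using set_partitions_sum_card(3)[of P r B] P by auto
    then have "(\<Prod>B\<in>P. expectation (\<lambda>\<omega>. Y \<omega> ^ card B)) = 0"
      using B mean set_partitions_sum_card(1)[of P r] P
      by (intro prod_zero bexI[of _ B]) auto
    then show ?thesis by simp
  qed
  then have "cumulant M r Y = (\<Sum>P\<in>?Q. ?t P)"
    unfolding cumulant_def using finite_set_partitions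
    by (intro sum.mono_neutral_right) auto
  also have "\<bar>\<dots>\<bar> \<le> (\<Sum>P\<in>?Q. fact (card P - 1) * expectation (\<lambda>\<omega>. \<bar>Y \<omega>\<bar> ^ r))"
  proof (rule order_trans[OF sum_abs sum_mono])
    fix P assume "P \<in> ?Q"
    then have P: "P \<in> set_partitions r" by simp
    have "\<bar>\<Prod>B\<in>P. expectation (\<lambda>\<omega>. Y \<omega> ^ card B)\<bar>
        \<le> (\<Prod>B\<in>P. expectation (\<lambda>\<omega>. \<bar>Y \<omega>\<bar> ^ card B))"
      unfolding abs_prod using integral_abs_bound[of M "\<lambda>\<omega>. Y \<omega> ^ card _"]
      by (intro prod_mono) (auto simp: power_abs)
    also have "\<dots> \<le> expectation (\<lambda>\<omega>. \<bar>Y \<omega>\<bar> ^ r)"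
      by (rule prod_moments_le[OF Y r P])
    finally show "\<bar>?t P\<bar> \<le> fact (card P - 1) * expectation (\<lambda>\<omega>. \<bar>Y \<omega>\<bar> ^ r)"
      by (simp add: abs_mult power_abs)
  qed
  also have "\<dots> = C_cen r * expectation (\<lambda>\<omega>. \<bar>Y \<omega>\<bar> ^ r)"
    by (simp add: C_cen_def sum_distrib_right)
  finally show ?thesis .
qed

section \<open>The cumulant bound for normalized sums\<close>

theorem proposition8p1:
  fixes M :: "'a measure" and X :: "nat \<Rightarrow> 'a \<Rightarrow> real" and r N :: nat
  assumes "prob_space M"
    and "2 \<le> r"
    and "prob_space.indep_vars M (\<lambda>_. borel) X {1..N}"
    and "\<And>i. i \<in> {1..N} \<Longrightarrow> integrable M (X i)"
    and "\<And>i. i \<in> {1..N} \<Longrightarrow>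
           integrable M (\<lambda>\<omega>. \<bar>X i \<omega> - prob_space.expectation M (X i)\<bar> ^ r)"
    and "\<And>i. i \<in> {1..N} \<Longrightarrow>
           integrable M (\<lambda>\<omega>. (X i \<omega> - prob_space.expectation M (X i))\<^sup>2)"
    and "0 < variance_sum M X N"
  shows "\<bar>cumulant M r (normalized_sum M X N)\<bar> \<le>
           C_cen r * variance_sum M X N powr (- (real r / 2)) *
           (\<Sum>i = 1..N. prob_space.expectation M
              (\<lambda>\<omega>. \<bar>X i \<omega> - prob_space.expectation M (X i)\<bar> ^ r))"
proof -
  interpret prob_space M by (rule assms(1))
  define Y where "Y i \<omega> = X i \<omega> - expectation (X i)" for i \<omega>
  define V where "V = variance_sum M X N"
  have V: "0 < V" using assms(7) by (simp add: V_def)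
  have meas: "Y i \<in> borel_measurable M" if "i \<in> {1..N}" for i
    using assms(4)[OF that] by (simp add: Y_def[abs_def])
  have int: "integrable M (\<lambda>\<omega>. \<bar>Y i \<omega>\<bar> ^ r)" if "i \<in> {1..N}" for i
    using assms(5)[OF that] by (simp add: Y_def)
  have mean: "expectation (Y i) = 0" if "i \<in> {1..N}" for i
    using assms(4)[OF that] by (simp add: Y_def[abs_def] prob_space)
  have indep: "indep_vars (\<lambda>_. borel) Y {1..N}"
    using indep_vars_compose2[OF assms(3), of "\<lambda>i x. x - expectation (X i)" "\<lambda>_. borel"]
    by (simp add: Y_def[abs_def])
  have "normalized_sum M X N = (\<lambda>\<omega>. (\<Sum>i=1..N. Y i \<omega>) / sqrt V)"
    by (simp add: normalized_sum_def[abs_def] centered_sum_def Y_def V_def)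
  then have "cumulant M r (normalized_sum M X N)
      = cumulant M r (\<lambda>\<omega>. \<Sum>i=1..N. Y i \<omega>) / sqrt V ^ r"
    by (simp only: cumulant_scale)
  also have "\<dots> = (\<Sum>i=1..N. cumulant M r (Y i)) * V powr (- (real r / 2))"
  proof -
    have "sqrt V ^ r = V powr (real r / 2)"
      using V powr_realpow[of "sqrt V" r] powr_half_sqrt[of V] powr_powr[of V "1/2" "real r"]
      by simp
    moreover have "cumulant M r (\<lambda>\<omega>. \<Sum>i=1..N. Y i \<omega>) = (\<Sum>i=1..N. cumulant M r (Y i))"
      using assms(2) integrable_power_le[OF meas int]
      by (intro cumulant_sum_indep indep) auto
    ultimately show ?thesis
      by (simp add: powr_minus_divide)
  qed
  also have "\<bar>\<dots>\<bar> \<le> (\<Sum>i=1..N. C_cen r * expectation (\<lambda>\<omega>. \<bar>Y i \<omega>\<bar> ^ r)) * V powr (- (real r / 2))"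
    unfolding abs_mult using assms(2)
    by (intro mult_mono order_trans[OF sum_abs sum_mono] abs_cumulant_centered_le meas int mean)
       (auto intro!: sum_nonneg mult_nonneg_nonneg simp: C_cen_def)
  finally show ?thesis
    by (simp add: Y_def V_def sum_distrib_left mult_ac)
qed

end
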